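(* For all integers $p\ge1$, $$R^{(p)}(t)=1+t\sum_{n=0}^\infty\binom{p-1+n}{n}(1+t)^n\prod_{i=1}^n\left(1-\left(\frac{1}{1+t}\right)^i\right).$$
   Context: For a finite integer sequence $(a_1,\dots,a_i)$, $\mathrm{asc}(a_1,\dots,a_i)=|\{j:1\le j<i,\ a_j<a_{j+1}\}|$. For an integer $p\ge1$, a $p$-ascent sequence of length $n\ge1$ is a sequence $(a_1,\dots,a_n)$ of nonnegative integers with $a_1=0$ and $a_i\le p+\mathrm{asc}(a_1,\dots,a_{i-1})$ for all $2\le i\le n$. Let $r_{n,p}$ be the number of $p$-ascent sequences of length $n$ having no two equal consecutive letters (primitive $p$-ascent sequences), and $R^{(p)}(t)=1+\sum_{n\ge1}r_{n,p}t^n$. *)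

theory Defs
  imports "HOL-Computational_Algebra.Formal_Power_Series"
begin

text \<open>
  A sequence \<open>(a\<^sub>1, \<dots>, a\<^sub>n)\<close> is represented by the list \<open>xs\<close> with \<open>xs ! (i - 1) = a\<^sub>i\<close>,
  so indices are shifted down by one and \<open>take i xs\<close> is the prefix \<open>(a\<^sub>1, \<dots>, a\<^sub>i)\<close>.
\<close>

definition asc :: "'a::linorder list \<Rightarrow> nat" where
  "asc xs = card {j. Suc j < length xs \<and> xs ! j < xs ! Suc j}"

definition p_ascent_seq :: "nat \<Rightarrow> nat list \<Rightarrow> bool" where
  "p_ascent_seq p xs \<longleftrightarrow>
     xs \<noteq> [] \<and> xs ! 0 = 0 \<and>
     (\<forall>i. 1 \<le> i \<and> i < length xs \<longrightarrow> xs ! i \<le> p + asc (take i xs))"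

definition primitive :: "'a list \<Rightarrow> bool" where
  "primitive xs \<longleftrightarrow> (\<forall>j. Suc j < length xs \<longrightarrow> xs ! j \<noteq> xs ! Suc j)"

definition primitive_p_ascent_seqs :: "nat \<Rightarrow> nat \<Rightarrow> nat list set" where
  "primitive_p_ascent_seqs n p = {xs. length xs = n \<and> p_ascent_seq p xs \<and> primitive xs}"

lemma asc_le_length: "asc xs \<le> length xs"
proof -
  have "card {j. Suc j < length xs \<and> xs ! j < xs ! Suc j} \<le> card {..<length xs}"
    by (rule card_mono) auto
  then show ?thesis by (simp add: asc_def)
qed

text \<open>Hence the cardinality in the next definition is a genuine count.\<close>

lemma finite_primitive_p_ascent_seqs: "finite (primitive_p_ascent_seqs n p)"
proof (rule finite_subset)
  show "primitive_p_ascent_seqs n p \<subseteq> {xs. set xs \<subseteq> {..p + n} \<and> length xs = n}"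
  proof
    fix xs assume "xs \<in> primitive_p_ascent_seqs n p"
    then have n: "length xs = n" and a: "p_ascent_seq p xs"
      by (auto simp: primitive_p_ascent_seqs_def)
    have "xs ! i \<le> p + n" if "i < n" for i
    proof (cases "i = 0")
      case True
      then show ?thesis using a by (simp add: p_ascent_seq_def)
    next
      case False
      then have "xs ! i \<le> p + asc (take i xs)" using a n that by (simp add: p_ascent_seq_def)
      also have "\<dots> \<le> p + n" using asc_le_length[of "take i xs"] n by simp
      finally show ?thesis .
    qed
    then show "xs \<in> {xs. set xs \<subseteq> {..p + n} \<and> length xs = n}"
      using n by (auto simp: in_set_conv_nth)
  qed
  show "finite {xs. set xs \<subseteq> {..p + n} \<and> length xs = n}"
    by (rule finite_lists_length_eq) simp
qed

definition r :: "nat \<Rightarrow> nat \<Rightarrow> nat" where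
  "r n p = card (primitive_p_ascent_seqs n p)"

text \<open>Rational coefficients are used so that \<open>1 + fps_X\<close> can be inverted by division.\<close>

definition R :: "nat \<Rightarrow> rat fps" where
  "R p = Abs_fps (\<lambda>n. if n = 0 then 1 else of_nat (r n p))"

end

theory Submission
  imports Defs
begin

text \<open>
  Let \<open>F(u, v)\<close> be the generating function of the sequences by length (\<open>t\<close>), number of ascents
  (\<open>u\<close>) and last letter (\<open>v\<close>). Appending a letter gives
  \<open>(v - 1 - t (1 - u v)) F(u, v) = t (v - 1) - t F(u, 1) + t u v\<^sup>p\<^sup>+\<^sup>1 F(u v, 1)\<close>,
  and the kernel \<open>v - 1 - t (1 - u v)\<close> vanishes for \<open>u = 1/(1 + s)\<close>, \<open>v = (1 + s)/(1 + x s)\<close>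
  with \<open>x = 1/(1 + t)\<close>. In this parametrisation \<open>u v = 1/(1 + x s)\<close>, so \<open>G(s) = u\<^sup>p\<^sup>+\<^sup>1 F(u, 1)\<close>
  satisfies \<open>(1 + s) G(s) = G(x s) + s (1 - x) / ((1 + x s) (1 + s)\<^sup>p)\<close>. Comparing powers of \<open>s\<close>
  expresses the \<open>m\<close>-th coefficient by the next one, with factor \<open>1 - x\<^sup>m\<^sup>+\<^sup>1\<close> divisible by \<open>t\<close>.
  Iterating from \<open>G(0) = F(1, 1) = R(t) - 1\<close> gives a double sum whose inner sum telescopes.
\<close>

section \<open>Appending one letter\<close>

lemma asc_append_singleton:
  assumes "xs \<noteq> []"
  shows "asc (xs @ [j]) = asc xs + (if last xs < j then 1 else 0)"
proof -
  let ?n = "length xs - 1"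
  have "{i. Suc i < length (xs @ [j]) \<and> (xs @ [j]) ! i < (xs @ [j]) ! Suc i}
      = {i. Suc i < length xs \<and> xs ! i < xs ! Suc i} \<union> (if last xs < j then {?n} else {})"
  proof (rule set_eqI)
    fix i
    have "last xs = xs ! i" if "Suc i = length xs"
      using assms that by (metis diff_Suc_1 last_conv_nth)
    then show "i \<in> {i. Suc i < length (xs @ [j]) \<and> (xs @ [j]) ! i < (xs @ [j]) ! Suc i} \<longleftrightarrow>
      i \<in> {i. Suc i < length xs \<and> xs ! i < xs ! Suc i} \<union> (if last xs < j then {?n} else {})"
      using assms
      by (cases "Suc i" "length xs" rule: linorder_cases) (auto simp: nth_append)
  qed
  moreover have "finite {i. Suc i < length xs \<and> xs ! i < xs ! Suc i}"
    by (rule finite_subset[of _ "{..<length xs}"]) auto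
  moreover have "?n \<notin> {i. Suc i < length xs \<and> xs ! i < xs ! Suc i}"
    by auto
  ultimately show ?thesis
    unfolding asc_def by (cases "last xs < j") (simp_all del: length_append)
qed

lemma p_ascent_seq_append_singleton:
  assumes "xs \<noteq> []"
  shows "p_ascent_seq p (xs @ [j]) \<longleftrightarrow> p_ascent_seq p xs \<and> j \<le> p + asc xs"
proof -
  have "(\<forall>i. 1 \<le> i \<and> i < Suc (length xs) \<longrightarrow>
           (xs @ [j]) ! i \<le> p + asc (take i (xs @ [j]))) \<longleftrightarrow>
        (\<forall>i. 1 \<le> i \<and> i < length xs \<longrightarrow> xs ! i \<le> p + asc (take i xs)) \<and> j \<le> p + asc xs"
    using assms by (auto simp: less_Suc_eq nth_append Suc_le_eq)
  then show ?thesis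
    using assms by (auto simp: p_ascent_seq_def nth_append)
qed

lemma primitive_append_singleton:
  assumes "xs \<noteq> []"
  shows "primitive (xs @ [j]) \<longleftrightarrow> primitive xs \<and> last xs \<noteq> j"
  using assms unfolding primitive_def
  by (auto simp: nth_append last_conv_nth less_Suc_eq all_conj_distrib split: if_splits)
     (metis Suc_pred diff_Suc_1 length_greater_0_conv)+

lemma primitive_p_ascent_seqs_0: "primitive_p_ascent_seqs 0 p = {}"
  by (auto simp: primitive_p_ascent_seqs_def p_ascent_seq_def)

lemma primitive_p_ascent_seqs_1: "primitive_p_ascent_seqs (Suc 0) p = {[0]}"
  by (auto simp: primitive_p_ascent_seqs_def p_ascent_seq_def primitive_def length_Suc_conv)

text \<open>Appending a letter never lowers the number of ascents. The bound makes every letter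
  below the last one admissible as the next letter.\<close>

lemma last_le_p_plus_asc:
  assumes "p_ascent_seq p xs"
  shows "last xs \<le> p + asc xs"
proof (cases "butlast xs = []")
  case True
  then have "last xs = xs ! 0"
    using assms by (cases xs) (auto simp: p_ascent_seq_def split: if_splits)
  then show ?thesis
    using assms by (simp add: p_ascent_seq_def)
next
  case False
  have "xs = butlast xs @ [last xs]"
    using assms by (simp add: p_ascent_seq_def)
  then show ?thesis
    using p_ascent_seq_append_singleton[OF False, of p "last xs"]
      asc_append_singleton[OF False, of "last xs"] assms by simp
qed

lemma primitive_p_ascent_seqs_Suc:
  assumes "n \<ge> 1"
  shows "primitive_p_ascent_seqs (Suc n) p =
    (\<lambda>(xs, j). xs @ [j]) ` (SIGMA xs:primitive_p_ascent_seqs n p.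
       {..<last xs} \<union> {Suc (last xs)..p + asc xs})" (is "?L = ?R")
proof (intro equalityI subsetI)
  fix ys assume ys: "ys \<in> ?L"
  then obtain xs j where [simp]: "ys = xs @ [j]"
    by (cases ys rule: rev_cases) (auto simp: primitive_p_ascent_seqs_def)
  have ne: "xs \<noteq> []" using ys assms by (auto simp: primitive_p_ascent_seqs_def)
  show "ys \<in> ?R"
    using ys ne p_ascent_seq_append_singleton[OF ne, of p j] primitive_append_singleton[OF ne, of j]
    by (auto simp: primitive_p_ascent_seqs_def image_iff)
next
  fix ys assume "ys \<in> ?R"
  then obtain xs j where [simp]: "ys = xs @ [j]" and xs: "xs \<in> primitive_p_ascent_seqs n p"
    and j: "j < last xs \<or> last xs < j \<and> j \<le> p + asc xs"
    by auto
  have ne: "xs \<noteq> []" using xs assms by (auto simp: primitive_p_ascent_seqs_def)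
  have "last xs \<le> p + asc xs"
    using xs by (auto simp: primitive_p_ascent_seqs_def intro: last_le_p_plus_asc)
  then show "ys \<in> ?L"
    using xs j p_ascent_seq_append_singleton[OF ne, of p j] primitive_append_singleton[OF ne, of j]
    by (auto simp: primitive_p_ascent_seqs_def)
qed

section \<open>Functional equation for the generating function\<close>

text \<open>\<open>u\<close> and \<open>v\<close> are ring elements, since power series in s over
  power series in t are substituted for them later.\<close>

definition asc_last_gf :: "nat \<Rightarrow> nat \<Rightarrow> 'a::comm_ring_1 \<Rightarrow> 'a \<Rightarrow> 'a" where
  "asc_last_gf p n u v = (\<Sum>xs\<in>primitive_p_ascent_seqs n p. u ^ asc xs * v ^ last xs)"

lemma geometric_sum_atLeastAtMost:
  fixes v :: "'a::comm_ring_1"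
  assumes "a \<le> Suc b"
  shows "(v - 1) * (\<Sum>j=a..b. v ^ j) = v ^ Suc b - v ^ a"
proof -
  have "(\<Sum>j=a..b. v ^ Suc j - v ^ j) = v ^ Suc b - v ^ a"
    by (rule sum_Suc_diff) (use assms in simp)
  then show ?thesis
    by (simp add: sum_distrib_left algebra_simps sum_subtractf)
qed

text \<open>Next letters below and above the last one each give a geometric sum; the factor
  \<open>v - 1\<close> avoids division. The upper limit contributes \<open>v ^ asc xs\<close>, which
  merges with \<open>u ^ asc xs\<close> into the argument \<open>u * v\<close>.\<close>

lemma asc_last_gf_Suc:
  fixes u v :: "'a::comm_ring_1"
  assumes "n \<ge> 1"
  shows "(v - 1) * asc_last_gf p (Suc n) u v =
     (1 - u * v) * asc_last_gf p n u v - asc_last_gf p n u 1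
     + u * v ^ Suc p * asc_last_gf p n (u * v) 1"
proof -
  let ?S = "primitive_p_ascent_seqs n p"
  have ne: "xs \<noteq> []" if "xs \<in> ?S" for xs
    using that assms by (auto simp: primitive_p_ascent_seqs_def)
  have inj: "inj_on (\<lambda>(xs, j). xs @ [j]) A" for A :: "(nat list \<times> nat) set"
    by (auto simp: inj_on_def)
  have "asc_last_gf p (Suc n) u v =
    (\<Sum>xs\<in>?S. \<Sum>j\<in>{..<last xs} \<union> {Suc (last xs)..p + asc xs}.
        u ^ asc (xs @ [j]) * v ^ j)"
    unfolding asc_last_gf_def primitive_p_ascent_seqs_Suc[OF assms]
    by (subst sum.reindex[OF inj])
       (simp add: sum.Sigma finite_primitive_p_ascent_seqs case_prod_unfold)
  also have "\<dots> = (\<Sum>xs\<in>?S. (\<Sum>j<last xs. u ^ asc xs * v ^ j)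
      + (\<Sum>j=Suc (last xs)..p + asc xs. u ^ Suc (asc xs) * v ^ j))"
  proof (rule sum.cong[OF refl])
    fix xs assume xs: "xs \<in> ?S"
    have "(\<Sum>j\<in>{..<last xs} \<union> {Suc (last xs)..p + asc xs}. u ^ asc (xs @ [j]) * v ^ j)
      = (\<Sum>j<last xs. u ^ asc (xs @ [j]) * v ^ j)
        + (\<Sum>j=Suc (last xs)..p + asc xs. u ^ asc (xs @ [j]) * v ^ j)"
      by (rule sum.union_disjoint) auto
    also have "\<dots> = (\<Sum>j<last xs. u ^ asc xs * v ^ j)
        + (\<Sum>j=Suc (last xs)..p + asc xs. u ^ Suc (asc xs) * v ^ j)"
      by (intro arg_cong2[of _ _ _ _ "(+)"] sum.cong)
         (auto simp: asc_append_singleton[OF ne[OF xs]])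
    finally show "(\<Sum>j\<in>{..<last xs} \<union> {Suc (last xs)..p + asc xs}. u ^ asc (xs @ [j]) * v ^ j)
      = \<dots>" .
  qed
  finally have "(v - 1) * asc_last_gf p (Suc n) u v =
    (\<Sum>xs\<in>?S. u ^ asc xs * ((v - 1) * (\<Sum>j<last xs. v ^ j))
      + u ^ Suc (asc xs) * ((v - 1) * (\<Sum>j=Suc (last xs)..p + asc xs. v ^ j)))"
    by (simp add: sum_distrib_left distrib_left mult.left_commute)
  also have "\<dots> = (\<Sum>xs\<in>?S. u ^ asc xs * (v ^ last xs - 1)
      + u ^ Suc (asc xs) * (v ^ Suc (p + asc xs) - v ^ Suc (last xs)))"
  proof (rule sum.cong[OF refl])
    fix xs assume "xs \<in> ?S"
    \<comment> \<open>In the case of equality no ascent can be appended and the second sum is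
      empty.\<close>
    then have "Suc (last xs) \<le> Suc (p + asc xs)"
      by (auto simp: primitive_p_ascent_seqs_def intro: last_le_p_plus_asc)
    then show "u ^ asc xs * ((v - 1) * (\<Sum>j<last xs. v ^ j))
      + u ^ Suc (asc xs) * ((v - 1) * (\<Sum>j=Suc (last xs)..p + asc xs. v ^ j))
      = u ^ asc xs * (v ^ last xs - 1)
      + u ^ Suc (asc xs) * (v ^ Suc (p + asc xs) - v ^ Suc (last xs))"
      by (simp only: geometric_sum_atLeastAtMost power_diff_1_eq)
  qed
  also have "\<dots> = (1 - u * v) * asc_last_gf p n u v - asc_last_gf p n u 1
     + u * v ^ Suc p * asc_last_gf p n (u * v) 1"
    unfolding asc_last_gf_def sum_distrib_left sum_subtractf[symmetric] sum.distrib[symmetric]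
    by (rule sum.cong) (auto simp: algebra_simps power_add power_mult_distrib)
  finally show ?thesis .
qed

text \<open>The hypothesis makes the kernel vanish, so that the sum over all lengths telescopes.\<close>

lemma asc_last_gf_kernel:
  fixes t u v :: "'a::comm_ring_1"
  assumes "v - 1 = t * (1 - u * v)"
  shows "(v - 1) * (t ^ N * asc_last_gf p (Suc N) u v - 1) =
    (\<Sum>n\<le>N. t ^ n * (u * v ^ Suc p * asc_last_gf p n (u * v) 1 - asc_last_gf p n u 1))"
proof (induction N)
  case 0
  \<comment> \<open>Both sides vanish: no sequence has length 0, and \<open>[0]\<close> is the only
    one of length 1.\<close>
  then show ?case
    by (simp add: asc_last_gf_def primitive_p_ascent_seqs_0 primitive_p_ascent_seqs_1 asc_def)
next
  case (Suc N)
  let ?A = "asc_last_gf p (Suc N) u v"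
  let ?W = "u * v ^ Suc p * asc_last_gf p (Suc N) (u * v) 1 - asc_last_gf p (Suc N) u 1"
  have "(v - 1) * (t ^ Suc N * asc_last_gf p (Suc (Suc N)) u v - 1)
    = t ^ Suc N * ((v - 1) * asc_last_gf p (Suc (Suc N)) u v) - (v - 1)"
    by (simp add: algebra_simps)
  also have "\<dots> = t ^ N * (t * (1 - u * v)) * ?A + t ^ Suc N * ?W - (v - 1)"
    by (subst asc_last_gf_Suc) (simp_all add: algebra_simps)
  also have "\<dots> = (v - 1) * (t ^ N * ?A - 1) + t ^ Suc N * ?W"
    by (subst assms[symmetric]) (simp add: algebra_simps)
  finally show ?case
    unfolding Suc.IH by simp
qed

section \<open>Power series in s and the recurrence for the coefficients of G\<close>

unbundle fps_syntax

text \<open>The inverse of 1 + c s, given by coefficients because the ring need not have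
  division.\<close>

definition fps_geometric :: "'a::comm_ring_1 \<Rightarrow> 'a fps" where
  "fps_geometric c = Abs_fps (\<lambda>m. (- c) ^ m)"

lemma fps_geometric_mult: "(1 + fps_const c * fps_X) * fps_geometric c = 1"
proof (rule fps_ext)
  fix m show "((1 + fps_const c * fps_X) * fps_geometric c) $ m = 1 $ m"
    by (cases m) (simp_all add: fps_geometric_def distrib_right mult.assoc)
qed

text \<open>By Pascal's rule, multiplying the series claimed for exponent \<open>k + 2\<close> by 1
  + c s gives the one for exponent \<open>k + 1\<close>.\<close>

lemma fps_geometric_power_nth:
  "(fps_geometric c ^ Suc k) $ m = (- c) ^ m * of_nat ((k + m) choose m)"
proof -
  define B where "B k = Abs_fps (\<lambda>m. (- c) ^ m * of_nat ((k + m) choose m))" for k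
  have step: "(1 + fps_const c * fps_X) * B (Suc k) = B k" for k
  proof (rule fps_ext)
    fix m show "((1 + fps_const c * fps_X) * B (Suc k)) $ m = B k $ m"
      by (cases m) (simp_all add: B_def distrib_right mult.assoc algebra_simps)
  qed
  have "fps_geometric c ^ Suc k = B k"
  proof (induction k)
    case 0
    show ?case by (simp add: B_def fps_geometric_def)
  next
    case (Suc k)
    have "B (Suc k) = ((1 + fps_const c * fps_X) * fps_geometric c) * B (Suc k)"
      by (simp add: fps_geometric_mult)
    also have "\<dots> = fps_geometric c * ((1 + fps_const c * fps_X) * B (Suc k))"
      by (simp only: ac_simps)
    also have "\<dots> = fps_geometric c ^ Suc (Suc k)"
      by (simp only: step Suc.IH[symmetric] power_Suc)
    finally show ?case ..
  qed
  then show ?thesis by (simp add: B_def)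
qed


text \<open>Up to the sign \<open>(-1)\<^sup>m\<close>, the coefficient of \<open>s\<^sup>m\<close> in \<open>G(s)\<close>.\<close>

definition asc_binomial_gf :: "nat \<Rightarrow> nat \<Rightarrow> 'a::comm_ring_1 fps" where
  "asc_binomial_gf p m =
     Abs_fps (\<lambda>n. \<Sum>xs\<in>primitive_p_ascent_seqs n p. of_nat ((p + asc xs + m) choose m))"

lemma fps_cutoff_eq_sum: "fps_cutoff (Suc N) g = (\<Sum>n\<le>N. fps_X ^ n * fps_const (g $ n))"
  for g :: "'a::comm_ring_1 fps"
proof (rule fps_ext)
  fix k
  have "(fps_X ^ n * fps_const (g $ n)) $ k = (if k = n then g $ n else 0)" for n
    by (simp add: fps_X_power_mult_nth)
  then show "fps_cutoff (Suc N) g $ k = (\<Sum>n\<le>N. fps_X ^ n * fps_const (g $ n)) $ k"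
    by (simp add: fps_sum_nth less_Suc_eq_le)
qed

text \<open>Comparison of the coefficients of s^(m+1) in the equation for G, with p = q + 1. The
  inner sum comes from 1 / ((1 + x s) (1 + s)^p), and \<open>x ^ Suc m\<close> from G(x s).\<close>

lemma asc_binomial_gf_rec:
  fixes x :: "'a::comm_ring_1 fps"
  assumes x: "x * (1 + fps_X) = 1"
  shows "asc_binomial_gf (Suc q) m =
    (1 - x) * (\<Sum>j=0..m. x ^ (m - j) * of_nat ((q + j) choose j))
    + (1 - x ^ Suc m) * asc_binomial_gf (Suc q) (Suc m)"
    (is "_ = (1 - x) * ?H + _")
proof (rule fps_ext)
  fix k
  \<comment> \<open>Truncation at \<open>N\<close> leaves an error divisible by t^N, which is
    invisible in coefficient \<open>k\<close> because \<open>k < N\<close>.\<close>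
  define N where "N = Suc k"
  define p where "p = Suc q"
  \<comment> \<open>The outer \<open>fps_X\<close> is s; the inner one, t, is a constant for
    it.\<close>
  define t :: "'a fps fps" where "t = fps_const fps_X"
  define w where "w = fps_geometric x"
  define u :: "'a fps fps" where "u = fps_geometric 1"
  define v where "v = (1 + fps_X) * w"
  let ?S = "\<lambda>n. primitive_p_ascent_seqs n p"
  define P :: "nat \<Rightarrow> 'a fps" where "P m = fps_cutoff (Suc N) (asc_binomial_gf p m)" for m
  have P: "P m = (\<Sum>n\<le>N. fps_X ^ n * (\<Sum>xs\<in>?S n. of_nat ((p + asc xs + m) choose m)))" for m
    unfolding P_def fps_cutoff_eq_sum asc_binomial_gf_def
    by (simp only: fps_nth_Abs_fps of_nat_sum[symmetric] fps_of_nat)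
  have tx: "fps_X * x = 1 - x"
    using x by (simp add: algebra_simps eq_diff_eq)
  have "(1 + fps_const 1 * fps_X) * u = 1"
    unfolding u_def by (rule fps_geometric_mult)
  then have uv: "u * v = w"
    by (simp add: v_def mult.assoc[symmetric] mult.commute[of u])
  have w: "1 = (1 + fps_const x * fps_X) * w"
    unfolding w_def by (rule fps_geometric_mult[symmetric])
  \<comment> \<open>Both sides of the kernel equation equal s (1 - x) w, because t x = 1 -
    x.\<close>
  have v1: "v - 1 = fps_X * (fps_const (1 - x) * w)"
    unfolding v_def by (subst (2) w) (simp add: algebra_simps fps_const_sub[symmetric] del: fps_const_sub)
  have "t * (1 - w) = t * (fps_const x * fps_X * w)"
    by (subst (1) w) (simp add: algebra_simps)
  also have "\<dots> = fps_const (fps_X * x) * fps_X * w"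
    by (simp add: t_def mult.assoc[symmetric])
  finally have ker: "v - 1 = t * (1 - u * v)"
    by (simp add: uv v1 tx mult_ac)
  define E where "E = fps_const (1 - x) * (u ^ p * w * asc_last_gf p (Suc N) u v)"
  \<comment> \<open>The factor \<open>u ^ p\<close> turns \<open>u * v ^ Suc p\<close> into
    \<open>w ^ Suc p\<close>, so that on the right only powers of the two geometric series
    \<open>w\<close> and \<open>u\<close> remain.\<close>
  have "u ^ p * ((v - 1) * (t ^ N * asc_last_gf p (Suc N) u v - 1)) =
    (\<Sum>n\<le>N. t ^ n * ((u * v) ^ Suc p * asc_last_gf p n (u * v) 1 - u ^ p * asc_last_gf p n u 1))"
    unfolding asc_last_gf_kernel[OF ker]
    by (simp add: sum_distrib_left power_mult_distrib algebra_simps)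
  also have "\<dots> = (\<Sum>n\<le>N. t ^ n * (\<Sum>xs\<in>?S n. w ^ Suc (p + asc xs) - u ^ Suc (q + asc xs)))"
    by (simp add: uv asc_last_gf_def sum_subtractf sum_distrib_left power_add p_def mult_ac)
  finally have eq: "fps_X * (t ^ N * E - fps_const (1 - x) * (u ^ p * w)) = \<dots>"
    unfolding v1 E_def by (simp add: algebra_simps)
  \<comment> \<open>This accounts for the factor 1 + s: up to sign, it expresses coefficients of
    \<open>u ^ (p + asc xs)\<close> through those of \<open>u ^ Suc (p + asc xs)\<close>.\<close>
  have pascal: "of_nat ((q + asc xs + Suc m) choose Suc m) =
      of_nat ((p + asc xs + Suc m) choose Suc m) - (of_nat ((p + asc xs + m) choose m) :: 'a fps)"
    for xs :: "nat list"
    by (simp add: p_def)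
  have "(u ^ p * w) $ m = (- 1) ^ m * ?H"
  proof -
    have "(u ^ p * w) $ m = (\<Sum>j=0..m. (- 1) ^ j * of_nat ((q + j) choose j) * (- x) ^ (m - j))"
      unfolding fps_mult_nth p_def u_def fps_geometric_power_nth by (simp add: w_def fps_geometric_def)
    also have "\<dots> = (\<Sum>j=0..m. (- 1) ^ m * (x ^ (m - j) * of_nat ((q + j) choose j)))"
    proof (rule sum.cong)
      fix j assume "j \<in> {0..m}"
      then have sign: "(- 1) ^ j * (- x) ^ (m - j) = (- 1) ^ m * x ^ (m - j)"
        by (simp add: power_minus[of x] mult.assoc[symmetric] power_add[symmetric])
      have "(- 1) ^ j * of_nat ((q + j) choose j) * (- x) ^ (m - j)
          = (- 1) ^ j * (- x) ^ (m - j) * of_nat ((q + j) choose j)"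
        by (simp only: mult_ac)
      then show "(- 1) ^ j * of_nat ((q + j) choose j) * (- x) ^ (m - j)
          = (- 1) ^ m * (x ^ (m - j) * of_nat ((q + j) choose j))"
        by (simp only: sign mult.assoc)
    qed simp
    finally show ?thesis by (simp add: sum_distrib_left)
  qed
  then have "fps_X ^ N * E $ m - (1 - x) * ((- 1) ^ m * ?H)
      = (fps_X * (t ^ N * E - fps_const (1 - x) * (u ^ p * w))) $ Suc m"
    by (simp add: t_def)
  also have "\<dots> = (\<Sum>n\<le>N. fps_X ^ n * (\<Sum>xs\<in>?S n.
      (- x) ^ Suc m * of_nat ((p + asc xs + Suc m) choose Suc m)
      - (- 1) ^ Suc m * of_nat ((q + asc xs + Suc m) choose Suc m)))"
    unfolding eq
    by (simp only: w_def u_def fps_sum_nth t_def fps_const_power fps_mult_left_const_nth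
        fps_sub_nth fps_geometric_power_nth)
  also have "\<dots> = (- 1) ^ m * ((1 - x ^ Suc m) * P (Suc m) - P m)"
    unfolding P pascal
    by (simp only: sum_distrib_left sum_subtractf[symmetric])
       (intro sum.cong refl, simp add: power_minus[of x] algebra_simps)
  finally have "(- 1) ^ m * P m = (- 1) ^ m * ((1 - x) * ?H + (1 - x ^ Suc m) * P (Suc m))
      - fps_X ^ N * E $ m"
    by (simp add: algebra_simps)
  then have "(- 1) ^ m * ((- 1) ^ m * P m) =
      (- 1) ^ m * ((- 1) ^ m * ((1 - x) * ?H + (1 - x ^ Suc m) * P (Suc m)) - fps_X ^ N * E $ m)"
    by simp
  then have "P m = (1 - x) * ?H + (1 - x ^ Suc m) * P (Suc m) - fps_X ^ N * ((- 1) ^ m * E $ m)"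
    by (simp add: right_diff_distrib mult.assoc[symmetric] power_add[symmetric]
        mult.commute[of "fps_X ^ N"])
  then have "P m $ k = ((1 - x) * ?H) $ k + ((1 - x ^ Suc m) * P (Suc m)) $ k
      - (fps_X ^ N * ((- 1) ^ m * E $ m)) $ k"
    by simp
  also have "(fps_X ^ N * ((- 1) ^ m * E $ m)) $ k = 0"
    unfolding fps_X_power_mult_nth by (simp add: N_def)
  finally show "asc_binomial_gf (Suc q) m $ k = ((1 - x) * ?H
      + (1 - x ^ Suc m) * asc_binomial_gf (Suc q) (Suc m)) $ k"
    unfolding P_def p_def by (simp add: N_def fps_cutoff_right_mult_nth)
qed

section \<open>Iterating the recurrence and summing the result\<close>

text \<open>Each summand is the difference of two consecutive products.\<close>

lemma q_prod_telescope:
  fixes x :: "'a::comm_ring_1"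
  assumes "j \<le> N"
  shows "(\<Sum>n=j..<N. x ^ Suc n * (\<Prod>i=1..n. 1 - x ^ i)) =
    (\<Prod>i=1..j. 1 - x ^ i) - (\<Prod>i=1..N. 1 - x ^ i)"
  using assms
proof (induction N rule: dec_induct)
  case base
  then show ?case by simp
next
  case (step n)
  then show ?case by (simp add: algebra_simps)
qed

lemma asc_binomial_gf_0_unfold:
  fixes x :: "'a::comm_ring_1 fps"
  assumes x: "x * (1 + fps_X) = 1"
  shows "asc_binomial_gf (Suc q) 0 =
    (1 - x) * (\<Sum>m<N. (\<Prod>i=1..m. 1 - x ^ i) * (\<Sum>j=0..m. x ^ (m - j) * of_nat ((q + j) choose j)))
    + (\<Prod>i=1..N. 1 - x ^ i) * asc_binomial_gf (Suc q) N"
proof (induction N)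
  case 0
  then show ?case by simp
next
  case (Suc N)
  show ?case
    by (subst Suc.IH, subst asc_binomial_gf_rec[OF x, of q N]) (simp add: algebra_simps)
qed

text \<open>As \<open>x\<close> is inverse to \<open>1 + fps_X\<close>, \<open>x ^ (m - j)\<close>
  splits into a factor depending on \<open>j\<close> only and \<open>x ^ Suc m\<close>. After
  exchanging the sums, the one over \<open>m\<close> telescopes. All multiples of the full product
  are collected in \<open>e\<close>.\<close>

lemma asc_binomial_gf_0_partial_sum:
  fixes x :: "'a::comm_ring_1 fps"
  assumes x: "x * (1 + fps_X) = 1"
  shows "\<exists>e. asc_binomial_gf (Suc q) 0 =
    fps_X * (\<Sum>j<N. of_nat ((q + j) choose j) * (1 + fps_X) ^ j * (\<Prod>i=1..j. 1 - x ^ i))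
    + (\<Prod>i=1..N. 1 - x ^ i) * e"
proof -
  let ?Q = "\<lambda>n. \<Prod>i=1..n. 1 - x ^ i"
  let ?y = "1 + fps_X :: 'a fps"
  let ?c = "\<lambda>j. of_nat ((q + j) choose j) :: 'a fps"
  have inv: "x ^ k * ?y ^ k = 1" for k
    using x by (simp add: power_mult_distrib[symmetric])
  have shift: "x ^ (m - j) = ?y ^ Suc j * x ^ Suc m" if "j \<le> m" for m j
  proof -
    have "x ^ Suc m = x ^ (m - j) * x ^ Suc j"
      using that by (simp add: power_add[symmetric] del: power_Suc)
    then have "?y ^ Suc j * x ^ Suc m = x ^ (m - j) * (x ^ Suc j * ?y ^ Suc j)"
      by (simp only: mult_ac)
    then show ?thesis
      by (simp only: inv mult_1_right)
  qed
  \<comment> \<open>This yields the outer factor t.\<close>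
  have y: "(1 - x) * ?y = fps_X"
    using x by (simp add: algebra_simps)
  have "(\<Sum>m<N. ?Q m * (\<Sum>j=0..m. x ^ (m - j) * ?c j))
    = (\<Sum>m<N. \<Sum>j=0..m. ?c j * ?y ^ Suc j * (x ^ Suc m * ?Q m))"
    unfolding sum_distrib_left by (intro sum.cong refl) (simp add: shift mult_ac del: power_Suc)
  also have "\<dots> = (\<Sum>j<N. \<Sum>m=j..<N. ?c j * ?y ^ Suc j * (x ^ Suc m * ?Q m))"
    by (subst sum.Sigma, simp, simp, subst sum.Sigma, simp, simp,
        rule sum.reindex_bij_witness[of _ "\<lambda>(a, b). (b, a)" "\<lambda>(a, b). (b, a)"]) auto
  also have "\<dots> = (\<Sum>j<N. ?c j * ?y ^ Suc j * (?Q j - ?Q N))"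
    unfolding sum_distrib_left[symmetric]
    by (intro sum.cong refl, subst q_prod_telescope) auto
  also have "\<dots> = ?y * (\<Sum>j<N. ?c j * ?y ^ j * ?Q j) - ?Q N * (\<Sum>j<N. ?c j * ?y ^ Suc j)"
    by (simp add: sum_distrib_left sum_subtractf[symmetric] algebra_simps)
  finally have sum_eq: "(\<Sum>m<N. ?Q m * (\<Sum>j=0..m. x ^ (m - j) * ?c j)) = \<dots>" .
  have "asc_binomial_gf (Suc q) 0 = (1 - x) * ?y * (\<Sum>j<N. ?c j * ?y ^ j * ?Q j)
    + ?Q N * (asc_binomial_gf (Suc q) N - (1 - x) * (\<Sum>j<N. ?c j * ?y ^ Suc j))"
    by (subst asc_binomial_gf_0_unfold[OF x, of q N], subst sum_eq)
       (simp add: algebra_simps)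
  then show ?thesis
    unfolding y by blast
qed

section \<open>Convergence in t and conclusion\<close>

text \<open>Each factor is divisible by \<open>1 - x\<close>, which equals
  \<open>fps_X * x\<close>.\<close>

lemma X_power_dvd_q_prod:
  fixes x :: "'a::comm_ring_1 fps"
  assumes x: "x * (1 + fps_X) = 1"
  shows "fps_X ^ n dvd (\<Prod>i=1..n. 1 - x ^ i)"
proof -
  have "1 - x = fps_X * x"
    using x by (simp add: algebra_simps)
  then have "fps_X dvd 1 - x ^ i" for i
    by (metis dvd_mult2 dvd_triv_left one_diff_power_eq)
  then have "(\<Prod>i=1..n. fps_X) dvd (\<Prod>i=1..n. 1 - x ^ i)"
    by (intro prod_dvd_prod)
  then show ?thesis by simp
qed

lemma fps_nth_eq_0_of_X_power_dvd: "fps_X ^ n dvd g \<Longrightarrow> k < n \<Longrightarrow> g $ k = 0"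
  for g :: "'a::comm_ring_1 fps"
  by (auto simp: dvd_def fps_X_power_mult_nth)

text \<open>Terms beyond \<open>n = k\<close> do not affect coefficient \<open>k\<close>, so the
  partial sums stabilise coefficientwise.\<close>

lemma fps_sums_of_X_power_dvd:
  fixes f :: "nat \<Rightarrow> 'a::comm_ring_1 fps"
  assumes "\<And>n. fps_X ^ n dvd f n"
  shows "f sums Abs_fps (\<lambda>k. (\<Sum>n<Suc k. f n) $ k)"
  unfolding sums_def tendsto_fps_iff
proof
  fix k
  have "(\<Sum>n<N. f n) $ k = (\<Sum>n<Suc k. f n) $ k" if "Suc k \<le> N" for N
    unfolding fps_sum_nth using that fps_nth_eq_0_of_X_power_dvd[OF assms, of k]
    by (intro sum.mono_neutral_right) auto
  then show "\<forall>\<^sub>F N in sequentially. (\<Sum>n<N. f n) $ k = Abs_fps (\<lambda>k. (\<Sum>n<Suc k. f n) $ k) $ k"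
    unfolding eventually_sequentially fps_nth_Abs_fps by blast
qed

text \<open>At \<open>m = 0\<close> all binomials are 1 and the sum is a count; length 0 counts
  nothing, hence the separate 1.\<close>

lemma R_eq_asc_binomial_gf: "R p = 1 + asc_binomial_gf p 0"
  by (rule fps_ext)
     (auto simp: R_def r_def asc_binomial_gf_def primitive_p_ascent_seqs_0)

theorem theorem3p5:
  fixes p :: nat and f :: "nat \<Rightarrow> rat fps"
  assumes "p \<ge> 1"
  defines "f \<equiv> (\<lambda>n. of_nat ((p - 1 + n) choose n) * (1 + fps_X) ^ n *
                     (\<Prod>i=1..n. 1 - (1 / (1 + fps_X)) ^ i))"
  shows "summable f \<and> R p = 1 + fps_X * (\<Sum>n. f n)"
proof -
  define x :: "rat fps" where "x = 1 / (1 + fps_X)"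
  have x: "x * (1 + fps_X) = 1"
    unfolding x_def by (simp add: fps_divide_unit inverse_mult_eq_1)
  have dvd: "fps_X ^ n dvd f n" for n
    using X_power_dvd_q_prod[OF x, of n] unfolding f_def x_def by (rule dvd_mult)
  note sums = fps_sums_of_X_power_dvd[of f, OF dvd]
  have "asc_binomial_gf p 0 = fps_X * (\<Sum>n. f n)"
  proof (rule fps_ext)
    fix k
    \<comment> \<open>With \<open>Suc k\<close> factors the product is divisible by
      \<open>fps_X ^ Suc k\<close>, so the remainder vanishes at \<open>k\<close>.\<close>
    obtain e where e: "asc_binomial_gf p 0 =
        fps_X * (\<Sum>n<Suc k. f n) + (\<Prod>i=1..Suc k. 1 - x ^ i) * e"
      using asc_binomial_gf_0_partial_sum[OF x, of "p - 1" "Suc k"] \<open>p \<ge> 1\<close>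
      unfolding f_def x_def by auto
    have "((\<Prod>i=1..Suc k. 1 - x ^ i) * e) $ k = 0"
      using X_power_dvd_q_prod[OF x, of "Suc k"]
      by (intro fps_nth_eq_0_of_X_power_dvd[of "Suc k"] dvd_mult2) auto
    \<comment> \<open>The factor \<open>fps_X\<close> shifts the index. Coefficient
      \<open>k - 1\<close> of the limit needs only the terms below \<open>k\<close>, and
      \<open>f k\<close> is divisible by \<open>fps_X ^ k\<close>.\<close>
    moreover have "(\<Sum>n<Suc k. f n) $ (k - 1) = (\<Sum>n. f n) $ (k - 1)" if "k \<noteq> 0"
      using that fps_nth_eq_0_of_X_power_dvd[OF dvd, of "k - 1" k]
      by (cases k) (simp_all add: sums_unique[OF sums, symmetric])
    ultimately show "asc_binomial_gf p 0 $ k = (fps_X * (\<Sum>n. f n)) $ k"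
      by (simp add: e)
  qed
  then show ?thesis
    using sums by (simp add: R_eq_asc_binomial_gf sums_iff)
qed

end
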